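(* Let $\mathcal{H}_1,\mathcal{H}_2$ be nonzero separable complex Hilbert spaces, $\mathcal{H}=\mathcal{H}_1\otimes\mathcal{H}_2$, and let $(X,\mu)=(X_1\times X_2,\mu_1\otimes\mu_2)$ be the product of measure spaces $(X_1,\mu_1)$, $(X_2,\mu_2)$ with $\sigma$-finite positive measures. Let $F_1:X_1\to\mathcal{H}_1$ and $F_2:X_2\to\mathcal{H}_2$ be mappings, and let $F=F_1\otimes F_2:X\to\mathcal{H}$, $F(x_1,x_2)=F_1(x_1)\otimes F_2(x_2)$. Then $F$ is a continuous frame for $\mathcal{H}$ with respect to $(X,\mu)$ if and only if $F_1$ is a continuous frame for $\mathcal{H}_1$ with respect to $(X_1,\mu_1)$ and $F_2$ is a continuous frame for $\mathcal{H}_2$ with respect to $(X_2,\mu_2)$. Furthermore, for $j=1,2$ put $$C_{F_j}=\inf_{\|h\|_{\mathcal{H}_j}=1}\int_{X_j}|\langle h,F_j(x_j)\rangle|^2\,d\mu_j(x_j),\qquad D_{F_j}=\sup_{\|h\|_{\mathcal{H}_j}=1}\int_{X_j}|\langle h,F_j(x_j)\rangle|^2\,d\mu_j(x_j).$$ If $F=F_1\otimes F_2$ is a continuous frame for $\mathcal{H}$ with lower and upper frame bounds $A$ and $B$, then $A_1=A/C_{F_2}$ and $B_1=B/D_{F_2}$ are lower and upper continuous frame bounds for $F_1$, and $A_2=A/C_{F_1}$ and $B_2=B/D_{F_1}$ are lower and upper continuous frame bounds for $F_2$. Conversely, if $F_j$ is a continuous frame for $\mathcal{H}_j$ with lower and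 upper frame bounds $A_j$ and $B_j$, $j=1,2$, then $A=A_1A_2$ and $B=B_1B_2$ are lower and upper frame bounds for $F=F_1\otimes F_2$.
   Context: $\mathcal{H}_1\otimes\mathcal{H}_2$ is the Hilbert space tensor product, with $\langle x_1\otimes y_1,x_2\otimes y_2\rangle=\langle x_1,x_2\rangle\langle y_1,y_2\rangle$. A mapping $F:X\to\mathcal{K}$ from a measure space $(X,\mu)$ with $\sigma$-finite positive measure into a separable complex Hilbert space $\mathcal{K}$ is a continuous frame for $\mathcal{K}$ with respect to $(X,\mu)$ if (1) it is weakly measurable, i.e. $x\mapsto\langle f,F(x)\rangle$ is measurable for every $f\in\mathcal{K}$; and (2) there are constants $A>0$ and $B<\infty$ (a lower and an upper continuous frame bound) such that $A\|f\|^2\le\int_X|\langle f,F(x)\rangle|^2\,d\mu(x)\le B\|f\|^2$ for all $f\in\mathcal{K}$. *)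

theory Defs
  imports "HOL-Analysis.Analysis"
begin

class complex_vector = real_vector +
  fixes scaleC :: "complex \<Rightarrow> 'a \<Rightarrow> 'a"  (infixr \<open>*\<^sub>C\<close> 75)
  assumes scaleC_add_right: "c *\<^sub>C (x + y) = c *\<^sub>C x + c *\<^sub>C y"
    and scaleC_add_left: "(c + d) *\<^sub>C x = c *\<^sub>C x + d *\<^sub>C x"
    and scaleC_scaleC: "c *\<^sub>C d *\<^sub>C x = (c * d) *\<^sub>C x"
    and scaleC_one: "1 *\<^sub>C x = x"
    and scaleR_scaleC: "r *\<^sub>R x = complex_of_real r *\<^sub>C x"

text \<open>The inner product is linear in the first argument.  The triangle inequality, which is part of
  \<^class>\<open>real_normed_vector\<close>, follows from the other axioms, so it restricts nothing.\<close>

class complex_inner = complex_vector + real_normed_vector +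
  fixes cinner :: "'a \<Rightarrow> 'a \<Rightarrow> complex"
  assumes cinner_commute: "cinner x y = cnj (cinner y x)"
    and cinner_add_left: "cinner (x + y) z = cinner x z + cinner y z"
    and cinner_scaleC_left: "cinner (c *\<^sub>C x) y = c * cinner x y"
    and cinner_self: "cinner x x = complex_of_real ((norm x)\<^sup>2)"

class chilbert_space = complex_inner + complete_space

interpretation complex_vector: vector_space "scaleC :: complex \<Rightarrow> 'a \<Rightarrow> 'a::complex_vector"
  by unfold_locales (simp_all add: scaleC_add_right scaleC_add_left scaleC_scaleC scaleC_one)

text \<open>The Hilbert space tensor product is unique up to a unitary map compatible with the elementary
  tensors.  The predicate says that the type \<open>'c\<close>, with \<open>tensor x y\<close> as the elementary tensor of
  \<open>x\<close> and \<open>y\<close>, is a Hilbert space tensor product of \<open>'a\<close> and \<open>'b\<close>, that is, a completion of the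
  algebraic tensor product for the product inner product.\<close>

locale hilbert_tensor_product =
  fixes tensor :: "'a::chilbert_space \<Rightarrow> 'b::chilbert_space \<Rightarrow> 'c::chilbert_space"
  assumes linear_left: "Vector_Spaces.linear scaleC scaleC (\<lambda>x. tensor x y)"
    and linear_right: "Vector_Spaces.linear scaleC scaleC (\<lambda>y. tensor x y)"
    and cinner_tensor: "cinner (tensor x1 y1) (tensor x2 y2) = cinner x1 x2 * cinner y1 y2"
    and dense_span: "closure (module.span scaleC {tensor x y | x y. True}) = UNIV"

instantiation complex :: chilbert_space
begin

definition scaleC_complex :: "complex \<Rightarrow> complex \<Rightarrow> complex" where
  "scaleC_complex c z = c * z"

definition cinner_complex :: "complex \<Rightarrow> complex \<Rightarrow> complex" where
  "cinner_complex z w = z * cnj w"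

instance
proof
  show "cinner x x = complex_of_real ((norm x)\<^sup>2)" for x :: complex
    unfolding cinner_complex_def by (rule complex_norm_square[symmetric])
qed (simp_all add: scaleC_complex_def cinner_complex_def distrib_left distrib_right
      scaleR_conv_of_real)

end

lemma hilbert_tensor_product_scaleC:
  "hilbert_tensor_product (scaleC :: complex \<Rightarrow> 'b \<Rightarrow> 'b::chilbert_space)"
proof
  have sc: "cinner x (c *\<^sub>C y) = cnj c * cinner x y" for c and x y :: 'b
    using cinner_commute[of x "c *\<^sub>C y"] cinner_commute[of x y] cinner_scaleC_left[of c y x] by simp
  show "cinner (x1 *\<^sub>C y1) (x2 *\<^sub>C y2) = cinner x1 x2 * cinner y1 y2" for x1 x2 and y1 y2 :: 'b
    by (simp add: cinner_scaleC_left sc cinner_complex_def)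
  have "{x *\<^sub>C y | x (y::'b). True} = UNIV"
    by (auto intro!: exI[of _ 1] simp: scaleC_one)
  then show "closure (module.span scaleC {x *\<^sub>C y | x (y::'b). True}) = UNIV"
    by simp
qed (simp_all add: scaleC_complex_def scaleC_add_left scaleC_add_right scaleC_scaleC mult.commute)

definition frame_integral :: "'x measure \<Rightarrow> ('x \<Rightarrow> 'k::chilbert_space) \<Rightarrow> 'k \<Rightarrow> ennreal" where
  "frame_integral M F f = (\<integral>\<^sup>+ x. ennreal ((cmod (cinner f (F x)))\<^sup>2) \<partial>M)"

definition weakly_measurable :: "'x measure \<Rightarrow> ('x \<Rightarrow> 'k::chilbert_space) \<Rightarrow> bool" where
  "weakly_measurable M F \<longleftrightarrow> (\<forall>f. (\<lambda>x. cinner f (F x)) \<in> borel_measurable M)"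

text \<open>Frame bounds are finite elements of \<^typ>\<open>ennreal\<close>, i.e. nonnegative reals.\<close>

definition lower_frame_bound :: "'x measure \<Rightarrow> ('x \<Rightarrow> 'k::chilbert_space) \<Rightarrow> ennreal \<Rightarrow> bool" where
  "lower_frame_bound M F A \<longleftrightarrow>
    0 < A \<and> A < \<infinity> \<and> (\<forall>f. A * ennreal ((norm f)\<^sup>2) \<le> frame_integral M F f)"

definition upper_frame_bound :: "'x measure \<Rightarrow> ('x \<Rightarrow> 'k::chilbert_space) \<Rightarrow> ennreal \<Rightarrow> bool" where
  "upper_frame_bound M F B \<longleftrightarrow>
    B < \<infinity> \<and> (\<forall>f. frame_integral M F f \<le> B * ennreal ((norm f)\<^sup>2))"

definition continuous_frame :: "'x measure \<Rightarrow> ('x \<Rightarrow> 'k::chilbert_space) \<Rightarrow> bool" where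
  "continuous_frame M F \<longleftrightarrow>
    sigma_finite_measure M \<and> separable_space (euclidean :: 'k topology) \<and>
    weakly_measurable M F \<and>
    (\<exists>A. lower_frame_bound M F A) \<and> (\<exists>B. upper_frame_bound M F B)"

definition frame_inf :: "'x measure \<Rightarrow> ('x \<Rightarrow> 'k::chilbert_space) \<Rightarrow> ennreal" where
  "frame_inf M F = (INF h \<in> {h. norm h = 1}. frame_integral M F h)"

definition frame_sup :: "'x measure \<Rightarrow> ('x \<Rightarrow> 'k::chilbert_space) \<Rightarrow> ennreal" where
  "frame_sup M F = (SUP h \<in> {h. norm h = 1}. frame_integral M F h)"

end

theory Submission
  imports Defs
begin

text \<open>Write \<open>I\<^sub>1\<close>, \<open>I\<^sub>2\<close>, \<open>I\<close> for the frame integrals of \<open>F1\<close>, \<open>F2\<close> and their tensor product \<open>F\<close>.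

  From the factors to the product.  Orthonormalizing the second components writes a finite sum of
  elementary tensors as \<open>f = \<Sum>\<^sub>e g\<^sub>e \<otimes> e\<close> with orthonormal \<open>e\<close>
  (\<open>algebraic_tensor_orthonormal_form\<close>), and then \<open>\<parallel>f\<parallel>\<^sup>2 = \<Sum>\<^sub>e \<parallel>g\<^sub>e\<parallel>\<^sup>2\<close>.  For a fixed point \<open>x\<close> of the
  first space the coefficient \<open>\<langle>f, F(x, y)\<rangle>\<close> equals \<open>\<langle>v\<^sub>x, F2 y\<rangle>\<close> with
  \<open>v\<^sub>x = \<Sum>\<^sub>e \<langle>g\<^sub>e, F1 x\<rangle> e\<close>.  So the bounds of \<open>F2\<close> compare the inner integral in Tonelli's theorem
  with \<open>\<parallel>v\<^sub>x\<parallel>\<^sup>2 = \<Sum>\<^sub>e |\<langle>g\<^sub>e, F1 x\<rangle>|\<^sup>2\<close>, whose integral over \<open>x\<close> is \<open>\<Sum>\<^sub>e I\<^sub>1(g\<^sub>e)\<close>, and the bounds of \<open>F1\<close>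
  compare this with \<open>\<parallel>f\<parallel>\<^sup>2\<close>.  This finite argument replaces orthonormal bases of the factors and the
  Riesz representation of \<open>f\<close>, but it only reaches a dense subspace.  The bounds pass to the closure:
  the upper one by Fatou's lemma (\<open>upper_frame_bound_dense\<close>), the lower one because \<open>f \<mapsto> \<langle>f, F\<rangle>\<close> is
  continuous into \<open>L\<^sup>2\<close> once there is an upper bound (\<open>lower_frame_bound_dense\<close>).

  From the product to the factors.  By the lower bound, \<open>I\<close> is positive on nonzero
  vectors, so for nonzero \<open>u\<close>, \<open>v\<close> the coefficient \<open>\<langle>u \<otimes> v, F\<rangle>\<close> is nonzero at some point \<open>(a, b)\<close>.  The sections through this point are measurable and are
  nonzero multiples of the coefficients of \<open>F1\<close> and \<open>F2\<close> (\<open>weakly_measurable_factors\<close>).  Now Tonelli's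
  theorem gives \<open>I(f \<otimes> g) = I\<^sub>1(f) I\<^sub>2(g)\<close>, hence \<open>A \<parallel>f\<parallel>\<^sup>2 \<le> I\<^sub>1(f) I\<^sub>2(g) \<le> B \<parallel>f\<parallel>\<^sup>2\<close> for unit
  vectors \<open>g\<close>, and the infimum and the supremum over \<open>g\<close> give the bounds of \<open>F1\<close>
  (\<open>factor_frame_bounds\<close>).  The bounds of \<open>F2\<close> follow by symmetry.\<close>

section \<open>Complex inner product spaces\<close>

lemma cinner_add_right: "cinner x (y + z) = cinner x y + cinner x z"
  by (subst (1 2 3) cinner_commute) (simp add: cinner_add_left)

lemma cinner_scaleC_right: "cinner x (c *\<^sub>C y) = cnj c * cinner x y"
  by (subst (1 2) cinner_commute) (simp add: cinner_scaleC_left)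

lemma cinner_zero_left: "cinner 0 x = 0"
  using cinner_add_left[of 0 0 x] by simp

lemma cinner_zero_right: "cinner x 0 = 0"
  using cinner_add_right[of x 0 0] by simp

lemma cinner_diff_left: "cinner (x - y) z = cinner x z - cinner y z"
  using cinner_add_left[of "x - y" y z] by simp

lemma cinner_sum_left: "cinner (\<Sum>i\<in>I. v i) z = (\<Sum>i\<in>I. cinner (v i) z)"
  by (induction I rule: infinite_finite_induct) (simp_all add: cinner_zero_left cinner_add_left)

lemma norm_scaleC: "norm (c *\<^sub>C x) = cmod c * norm (x::'a::complex_inner)"
proof -
  have "complex_of_real ((norm (c *\<^sub>C x))\<^sup>2) = complex_of_real ((cmod c * norm x)\<^sup>2)"
    unfolding cinner_self[symmetric] cinner_scaleC_left cinner_scaleC_right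
    by (simp add: cinner_self power_mult_distrib complex_norm_square[of c] mult.assoc
        del: of_real_power)
  then have "(norm (c *\<^sub>C x))\<^sup>2 = (cmod c * norm x)\<^sup>2"
    using of_real_eq_iff by blast
  then show ?thesis by (simp add: power2_eq_iff_nonneg)
qed

lemma norm_add_orthogonal:
  fixes x y :: "'a::complex_inner"
  assumes "cinner x y = 0"
  shows "(norm (x + y))\<^sup>2 = (norm x)\<^sup>2 + (norm y)\<^sup>2"
proof -
  have yx: "cinner y x = 0" using assms cinner_commute[of y x] by simp
  have "complex_of_real ((norm (x + y))\<^sup>2) = complex_of_real ((norm x)\<^sup>2 + (norm y)\<^sup>2)"
    unfolding cinner_self[symmetric] of_real_add
    by (simp add: cinner_add_left cinner_add_right assms yx)
  then show ?thesis using of_real_eq_iff by blast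
qed

lemma norm_sum_orthogonal:
  fixes v :: "'i \<Rightarrow> 'a::complex_inner"
  assumes "finite I" and "pairwise (\<lambda>i j. cinner (v i) (v j) = 0) I"
  shows "(norm (\<Sum>i\<in>I. v i))\<^sup>2 = (\<Sum>i\<in>I. (norm (v i))\<^sup>2)"
  using assms
proof (induction I)
  case (insert i I)
  have "cinner (\<Sum>j\<in>I. v j) (v i) = 0"
    using insert by (auto simp: cinner_sum_left pairwise_def intro!: sum.neutral)
  then have "cinner (v i) (\<Sum>j\<in>I. v j) = 0"
    using cinner_commute[of "v i" "\<Sum>j\<in>I. v j"] by simp
  then show ?case
    using insert by (simp add: norm_add_orthogonal pairwise_insert)
qed simp

lemma cinner_cauchy_schwarz: "cmod (cinner x y) \<le> norm x * norm (y::'a::complex_inner)"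
proof (cases "y = 0")
  case False
  \<comment> \<open>\<open>c *\<^sub>C y\<close> is the orthogonal projection of \<open>x\<close> onto the line through \<open>y\<close>.\<close>
  define c where "c = cinner x y / complex_of_real ((norm y)\<^sup>2)"
  have "cinner (x - c *\<^sub>C y) (c *\<^sub>C y) = 0"
    using False by (simp add: cinner_diff_left cinner_scaleC_left cinner_scaleC_right cinner_self c_def)
  from norm_add_orthogonal[OF this] have "(cmod c * norm y)\<^sup>2 \<le> (norm x)\<^sup>2"
    by (simp add: norm_scaleC)
  then have "cmod c * norm y \<le> norm x"
    using norm_ge_zero power2_le_imp_le by blast
  then show ?thesis
    using False by (simp add: c_def norm_divide norm_mult power2_eq_square divide_simps
        split: if_splits)
qed (simp add: cinner_zero_right)

lemma tendsto_cinner_left: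
  fixes f :: "'i \<Rightarrow> 'a::complex_inner"
  assumes "(f \<longlongrightarrow> l) G"
  shows "((\<lambda>n. cinner (f n) y) \<longlongrightarrow> cinner l y) G"
proof -
  have "bounded_linear (\<lambda>x. cinner x y)"
  proof (rule bounded_linear_intro[where K = "norm y"])
    show "cinner (r *\<^sub>R x) y = r *\<^sub>R cinner x y" for r x
      by (simp add: scaleR_scaleC cinner_scaleC_left scaleC_complex_def)
  qed (simp_all add: cinner_add_left cinner_cauchy_schwarz)
  then show ?thesis using assms by (rule bounded_linear.tendsto)
qed

definition orthonormal :: "'a::complex_inner set \<Rightarrow> bool" where
  "orthonormal E \<longleftrightarrow> (\<forall>e\<in>E. norm e = 1) \<and> pairwise (\<lambda>e e'. cinner e e' = 0) E"

text \<open>One step of the Gram-Schmidt process.\<close>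

lemma orthonormal_extend:
  fixes x :: "'a::complex_inner"
  assumes "finite E" "orthonormal E"
  obtains E' c where "finite E'" "E \<subseteq> E'" "orthonormal E'" "x = (\<Sum>e\<in>E'. c e *\<^sub>C e)"
proof -
  define r where "r = x - (\<Sum>e\<in>E. cinner x e *\<^sub>C e)"
  have x: "x = r + (\<Sum>e\<in>E. cinner x e *\<^sub>C e)" by (simp add: r_def)
  have r_e: "cinner r e = 0" if "e \<in> E" for e
  proof -
    have "cinner (\<Sum>d\<in>E. cinner x d *\<^sub>C d) e = (\<Sum>d\<in>E. if d = e then cinner x e else 0)"
      unfolding cinner_sum_left
    proof (rule sum.cong)
      fix d assume "d \<in> E"
      then show "cinner (cinner x d *\<^sub>C d) e = (if d = e then cinner x e else 0)"
        using assms(2) that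
        by (auto simp: orthonormal_def pairwise_def cinner_scaleC_left cinner_self)
    qed simp
    also have "\<dots> = cinner x e" using assms(1) that by simp
    finally show ?thesis by (simp add: r_def cinner_diff_left)
  qed
  show thesis
  proof (cases "r = 0")
    case True
    then show thesis using that[of E "cinner x"] assms x by simp
  next
    case False
    define u where "u = complex_of_real (1 / norm r) *\<^sub>C r"
    have u: "norm u = 1" using False by (simp add: u_def norm_scaleC norm_divide)
    have ue: "cinner u e = 0" "cinner e u = 0" if "e \<in> E" for e
      using r_e[OF that] cinner_commute[of e u] by (simp_all add: u_def cinner_scaleC_left)
    have "u \<notin> E" using ue(1)[of u] u cinner_self[of u] by auto
    have r: "r = complex_of_real (norm r) *\<^sub>C u"
      using False by (simp add: u_def scaleC_scaleC scaleC_one)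
    show thesis
    proof (rule that[of "insert u E" "(cinner x)(u := complex_of_real (norm r))"])
      show "orthonormal (insert u E)"
        using assms u ue by (auto simp: orthonormal_def pairwise_insert)
      have "(\<Sum>e\<in>E. ((cinner x)(u := complex_of_real (norm r))) e *\<^sub>C e) = (\<Sum>e\<in>E. cinner x e *\<^sub>C e)"
        using \<open>u \<notin> E\<close> by (intro sum.cong) auto
      then show "x = (\<Sum>e\<in>insert u E. ((cinner x)(u := complex_of_real (norm r))) e *\<^sub>C e)"
        using assms \<open>u \<notin> E\<close> r x by simp
    qed (use assms in auto)
  qed
qed

lemma norm_sum_orthonormal:
  assumes "finite E" "orthonormal E"
  shows "(norm (\<Sum>e\<in>E. c e *\<^sub>C e))\<^sup>2 = (\<Sum>e\<in>E. (cmod (c e))\<^sup>2)"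
proof -
  have "(norm (\<Sum>e\<in>E. c e *\<^sub>C e))\<^sup>2 = (\<Sum>e\<in>E. (norm (c e *\<^sub>C e))\<^sup>2)"
    using assms by (intro norm_sum_orthogonal)
      (auto simp: orthonormal_def pairwise_def cinner_scaleC_left cinner_scaleC_right)
  also have "\<dots> = (\<Sum>e\<in>E. (cmod (c e))\<^sup>2)"
    using assms by (intro sum.cong) (auto simp: orthonormal_def norm_scaleC)
  finally show ?thesis .
qed

section \<open>Extending frame bounds from a dense set\<close>

text \<open>The coefficient of a limit of vectors is the pointwise limit of their coefficients.\<close>

lemma weakly_measurable_dense:
  fixes F :: "'x \<Rightarrow> 'k::chilbert_space"
  assumes dense: "closure S = UNIV"
    and meas: "\<And>f. f \<in> S \<Longrightarrow> (\<lambda>x. cinner f (F x)) \<in> borel_measurable M"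
  shows "weakly_measurable M F"
  unfolding weakly_measurable_def
proof
  fix f :: 'k
  obtain s where s: "\<And>n. s n \<in> S" "s \<longlonglongrightarrow> f"
    using dense closure_sequential[of f S] by auto
  show "(\<lambda>x. cinner f (F x)) \<in> borel_measurable M"
    by (rule borel_measurable_LIMSEQ_metric[where f = "\<lambda>n x. cinner (s n) (F x)"])
      (use s meas in \<open>auto intro: tendsto_cinner_left\<close>)
qed

lemma frame_integral_measurable:
  assumes "weakly_measurable M F"
  shows "(\<lambda>x. ennreal ((cmod (cinner f (F x)))\<^sup>2)) \<in> borel_measurable M"
proof -
  have [measurable]: "(\<lambda>x. cinner f (F x)) \<in> borel_measurable M"
    using assms by (simp add: weakly_measurable_def)
  show ?thesis by measurable
qed

text \<open>Along a sequence in \<open>S\<close> converging to \<open>f\<close> the integrands converge pointwise, so Fatou's lemma applies.\<close>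

lemma upper_frame_bound_dense:
  fixes F :: "'x \<Rightarrow> 'k::chilbert_space"
  assumes dense: "closure S = UNIV" and wm: "weakly_measurable M F" and B: "B < \<infinity>"
    and bound: "\<And>f. f \<in> S \<Longrightarrow> frame_integral M F f \<le> B * ennreal ((norm f)\<^sup>2)"
  shows "upper_frame_bound M F B"
  unfolding upper_frame_bound_def
proof (intro conjI allI B)
  fix f :: 'k
  obtain s where s: "\<And>n. s n \<in> S" "s \<longlonglongrightarrow> f"
    using dense closure_sequential[of f S] by auto
  have "(\<lambda>n. ennreal ((cmod (cinner (s n) (F x)))\<^sup>2)) \<longlonglongrightarrow> ennreal ((cmod (cinner f (F x)))\<^sup>2)" for x
    by (intro tendsto_ennrealI tendsto_power tendsto_norm tendsto_cinner_left s)
  then have "liminf (\<lambda>n. ennreal ((cmod (cinner (s n) (F x)))\<^sup>2)) = ennreal ((cmod (cinner f (F x)))\<^sup>2)" for x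
    by (rule lim_imp_Liminf[OF sequentially_bot])
  then have "frame_integral M F f = (\<integral>\<^sup>+x. liminf (\<lambda>n. ennreal ((cmod (cinner (s n) (F x)))\<^sup>2)) \<partial>M)"
    by (simp add: frame_integral_def)
  also have "\<dots> \<le> liminf (\<lambda>n. frame_integral M F (s n))"
    unfolding frame_integral_def by (intro nn_integral_liminf frame_integral_measurable wm)
  also have "\<dots> \<le> liminf (\<lambda>n. B * ennreal ((norm (s n))\<^sup>2))"
    by (intro Liminf_mono always_eventually allI bound s)
  also have "\<dots> = B * ennreal ((norm f)\<^sup>2)"
  proof (rule lim_imp_Liminf[OF sequentially_bot])
    show "(\<lambda>n. B * ennreal ((norm (s n))\<^sup>2)) \<longlonglongrightarrow> B * ennreal ((norm f)\<^sup>2)"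
      using B by (intro ennreal_tendsto_cmult tendsto_ennrealI tendsto_power tendsto_norm s) auto
  qed
  finally show "frame_integral M F f \<le> B * ennreal ((norm f)\<^sup>2)" .
qed

lemma power2_add_le_weighted:
  fixes a b t :: real
  assumes "t > 0"
  shows "(a + b)\<^sup>2 \<le> (1 + t) * a\<^sup>2 + (1 + 1 / t) * b\<^sup>2"
proof -
  have "0 \<le> (t * a - b)\<^sup>2 / t" using assms by simp
  also have "\<dots> = (1 + t) * a\<^sup>2 + (1 + 1 / t) * b\<^sup>2 - (a + b)\<^sup>2"
    using assms by (simp add: field_simps power2_eq_square)
  finally show ?thesis by simp
qed

text \<open>A substitute for Minkowski's inequality: as \<open>t\<close> tends to zero, it shows that a small
  perturbation of \<open>f\<close> changes the integral little, and it needs no square roots of integrals.\<close>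

lemma frame_integral_add_le:
  assumes "weakly_measurable M F" "t > 0"
  shows "frame_integral M F (f + g)
    \<le> ennreal (1 + t) * frame_integral M F f + ennreal (1 + 1 / t) * frame_integral M F g"
proof -
  have "ennreal ((cmod (cinner (f + g) (F x)))\<^sup>2) \<le> ennreal (1 + t) * ennreal ((cmod (cinner f (F x)))\<^sup>2)
      + ennreal (1 + 1 / t) * ennreal ((cmod (cinner g (F x)))\<^sup>2)" for x
  proof -
    have "(cmod (cinner (f + g) (F x)))\<^sup>2 \<le> (cmod (cinner f (F x)) + cmod (cinner g (F x)))\<^sup>2"
      by (intro power_mono) (simp_all add: cinner_add_left norm_triangle_ineq)
    also note power2_add_le_weighted[OF \<open>t > 0\<close>]
    finally show ?thesis
      using \<open>t > 0\<close> by (simp add: ennreal_mult[symmetric] ennreal_plus[symmetric] del: ennreal_plus)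
  qed
  then have "frame_integral M F (f + g) \<le> (\<integral>\<^sup>+x. ennreal (1 + t) * ennreal ((cmod (cinner f (F x)))\<^sup>2)
      + ennreal (1 + 1 / t) * ennreal ((cmod (cinner g (F x)))\<^sup>2) \<partial>M)"
    unfolding frame_integral_def by (intro nn_integral_mono)
  also have "\<dots> = ennreal (1 + t) * frame_integral M F f + ennreal (1 + 1 / t) * frame_integral M F g"
    using frame_integral_measurable[OF assms(1)]
    by (simp add: frame_integral_def nn_integral_add nn_integral_cmult)
  finally show ?thesis .
qed

text \<open>Fatou's lemma bounds the integral of a limit only from above, so the lower bound needs another
  reason.  If \<open>s n\<close> tends to \<open>f\<close>, then \<open>I (s n) \<le> (1 + t) I f + (1 + 1 / t) I (s n - f)\<close>, where the upper
  bound makes the last term vanish in the limit.  Then \<open>t\<close> tends to zero.\<close>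

lemma lower_frame_bound_dense:
  fixes F :: "'x \<Rightarrow> 'k::chilbert_space"
  assumes dense: "closure S = UNIV" and wm: "weakly_measurable M F"
    and upper: "upper_frame_bound M F B" and A: "0 < A" "A < \<infinity>"
    and bound: "\<And>f. f \<in> S \<Longrightarrow> A * ennreal ((norm f)\<^sup>2) \<le> frame_integral M F f"
  shows "lower_frame_bound M F A"
  unfolding lower_frame_bound_def
proof (intro conjI allI A)
  fix f :: 'k
  obtain s where s: "\<And>n. s n \<in> S" "s \<longlonglongrightarrow> f"
    using dense closure_sequential[of f S] by auto
  have B: "B < \<infinity>" using upper by (simp add: upper_frame_bound_def)
  have weighted: "A * ennreal ((norm f)\<^sup>2) \<le> ennreal (1 + t) * frame_integral M F f" if "t > 0" for t
  proof (rule LIMSEQ_le)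
    show "(\<lambda>n. A * ennreal ((norm (s n))\<^sup>2)) \<longlonglongrightarrow> A * ennreal ((norm f)\<^sup>2)"
      using A by (intro ennreal_tendsto_cmult tendsto_ennrealI tendsto_power tendsto_norm s) auto
    have "(\<lambda>n. ennreal (1 + t) * frame_integral M F f
          + ennreal (1 + 1 / t) * (B * ennreal ((norm (s n - f))\<^sup>2)))
        \<longlonglongrightarrow> ennreal (1 + t) * frame_integral M F f + ennreal (1 + 1 / t) * (B * ennreal ((norm (f - f))\<^sup>2))"
      using B by (intro tendsto_add tendsto_const ennreal_tendsto_cmult tendsto_ennrealI
          tendsto_power tendsto_norm tendsto_diff s) auto
    then show "(\<lambda>n. ennreal (1 + t) * frame_integral M F f
          + ennreal (1 + 1 / t) * (B * ennreal ((norm (s n - f))\<^sup>2)))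
        \<longlonglongrightarrow> ennreal (1 + t) * frame_integral M F f"
      by simp
    have "A * ennreal ((norm (s n))\<^sup>2) \<le> ennreal (1 + t) * frame_integral M F f
          + ennreal (1 + 1 / t) * (B * ennreal ((norm (s n - f))\<^sup>2))" for n
    proof -
      have "A * ennreal ((norm (s n))\<^sup>2) \<le> frame_integral M F (f + (s n - f))"
        using bound[OF s(1)] by simp
      also have "\<dots> \<le> ennreal (1 + t) * frame_integral M F f
          + ennreal (1 + 1 / t) * frame_integral M F (s n - f)"
        using wm that by (rule frame_integral_add_le)
      also have "\<dots> \<le> ennreal (1 + t) * frame_integral M F f
          + ennreal (1 + 1 / t) * (B * ennreal ((norm (s n - f))\<^sup>2))"
        using upper by (intro add_left_mono mult_left_mono) (auto simp: upper_frame_bound_def)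
      finally show ?thesis .
    qed
    then show "\<exists>N. \<forall>n\<ge>N. A * ennreal ((norm (s n))\<^sup>2) \<le> ennreal (1 + t) * frame_integral M F f
          + ennreal (1 + 1 / t) * (B * ennreal ((norm (s n - f))\<^sup>2))"
      by blast
  qed
  have fin: "frame_integral M F f < \<infinity>"
    using upper by (auto simp: upper_frame_bound_def ennreal_mult_less_top intro: le_less_trans)
  show "A * ennreal ((norm f)\<^sup>2) \<le> frame_integral M F f"
  proof (rule LIMSEQ_le_const)
    have "(\<lambda>n. ennreal (1 + 1 / real (Suc n))) \<longlonglongrightarrow> ennreal (1 + 0)"
      by (intro tendsto_ennrealI tendsto_add tendsto_const LIMSEQ_Suc lim_1_over_n)
    from ennreal_tendsto_cmult[OF _ this, of "frame_integral M F f"] fin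
    show "(\<lambda>n. ennreal (1 + 1 / real (Suc n)) * frame_integral M F f) \<longlonglongrightarrow> frame_integral M F f"
      by (simp add: mult.commute)
  qed (use weighted in auto)
qed

section \<open>Elementary tensors and their span\<close>

context hilbert_tensor_product
begin

abbreviation tensor_map :: "('x \<Rightarrow> 'a) \<Rightarrow> ('y \<Rightarrow> 'b) \<Rightarrow> 'x \<times> 'y \<Rightarrow> 'c" where
  "tensor_map F1 F2 \<equiv> (\<lambda>(x1, x2). tensor (F1 x1) (F2 x2))"

definition algebraic_tensors :: "'c set" where
  "algebraic_tensors = module.span scaleC {tensor x y | x y. True}"

lemma closure_algebraic_tensors: "closure algebraic_tensors = UNIV"
  unfolding algebraic_tensors_def by (rule dense_span)

lemma tensor_add_left: "tensor (x + x') y = tensor x y + tensor x' y"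
  by (rule module_hom.add[OF Vector_Spaces.linear.axioms(3)[OF linear_left]])

lemma tensor_scaleC_left: "tensor (c *\<^sub>C x) y = c *\<^sub>C tensor x y"
  by (rule module_hom.scale[OF Vector_Spaces.linear.axioms(3)[OF linear_left]])

lemma tensor_add_right: "tensor x (y + y') = tensor x y + tensor x y'"
  by (rule module_hom.add[OF Vector_Spaces.linear.axioms(3)[OF linear_right]])

lemma tensor_scaleC_right: "tensor x (c *\<^sub>C y) = c *\<^sub>C tensor x y"
  by (rule module_hom.scale[OF Vector_Spaces.linear.axioms(3)[OF linear_right]])

lemma tensor_zero_left: "tensor 0 y = 0"
  using tensor_add_left[of 0 0 y] by simp

lemma tensor_zero_right: "tensor x 0 = 0"
  using tensor_add_right[of x 0 0] by simp

lemma tensor_sum_right: "tensor x (\<Sum>i\<in>I. v i) = (\<Sum>i\<in>I. tensor x (v i))"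
  by (induction I rule: infinite_finite_induct) (simp_all add: tensor_zero_right tensor_add_right)

lemma norm_tensor: "norm (tensor x y) = norm x * norm y"
proof -
  have "complex_of_real ((norm (tensor x y))\<^sup>2) = complex_of_real ((norm x * norm y)\<^sup>2)"
    unfolding cinner_self[symmetric] cinner_tensor by (simp add: cinner_self power_mult_distrib)
  then have "(norm (tensor x y))\<^sup>2 = (norm x * norm y)\<^sup>2"
    using of_real_eq_iff by blast
  then show ?thesis by (simp add: power2_eq_iff_nonneg)
qed

lemma algebraic_tensors_induct [consumes 1, case_names zero add]:
  assumes "f \<in> algebraic_tensors" and "P 0" and "\<And>x y f. P f \<Longrightarrow> P (tensor x y + f)"
  shows "P f"
  using assms(1) unfolding algebraic_tensors_def
proof (induction rule: complex_vector.span_induct_alt)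
  case base
  show ?case by (rule assms(2))
next
  case (step c z f)
  then obtain x y where "c *\<^sub>C z = tensor (c *\<^sub>C x) y"
    by (auto simp: tensor_scaleC_left)
  then show ?case using assms(3) step by metis
qed

text \<open>To add a further elementary tensor \<open>x \<otimes> y\<close>, the orthonormal set is enlarged until it
  spans \<open>y\<close>; then both tensors are expanded along the enlarged set.\<close>

lemma algebraic_tensor_orthonormal_form:
  assumes "f \<in> algebraic_tensors"
  obtains E g where "finite E" "orthonormal E" "f = (\<Sum>e\<in>E. tensor (g e) e)"
proof -
  have "\<exists>E g. finite E \<and> orthonormal E \<and> f = (\<Sum>e\<in>E. tensor (g e) e)"
    using assms
  proof (induction rule: algebraic_tensors_induct)
    case zero
    have "orthonormal {}" by (simp add: orthonormal_def)
    then show ?case by (intro exI[of _ "{}"]) simp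
  next
    case (add x y f)
    then obtain E g where E: "finite E" "orthonormal E" and f: "f = (\<Sum>e\<in>E. tensor (g e) e)"
      by blast
    obtain E' c where E': "finite E'" "E \<subseteq> E'" "orthonormal E'" and y: "y = (\<Sum>e\<in>E'. c e *\<^sub>C e)"
      using E by (rule orthonormal_extend)
    have "tensor x y = (\<Sum>e\<in>E'. tensor (c e *\<^sub>C x) e)"
      unfolding y tensor_sum_right by (simp add: tensor_scaleC_left tensor_scaleC_right)
    moreover have "f = (\<Sum>e\<in>E'. tensor (if e \<in> E then g e else 0) e)"
      unfolding f using E'
      by (intro sum.mono_neutral_cong_left) (auto simp: tensor_zero_left)
    ultimately have "tensor x y + f = (\<Sum>e\<in>E'. tensor (c e *\<^sub>C x + (if e \<in> E then g e else 0)) e)"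
      by (simp add: tensor_add_left sum.distrib)
    then show ?case
      using E' by (intro exI[of _ E'] exI[of _ "\<lambda>e. c e *\<^sub>C x + (if e \<in> E then g e else 0)"] conjI)
  qed
  then show thesis using that by blast
qed

lemma norm_orthonormal_form:
  assumes "finite E" "orthonormal E"
  shows "(norm (\<Sum>e\<in>E. tensor (g e) e))\<^sup>2 = (\<Sum>e\<in>E. (norm (g e))\<^sup>2)"
proof -
  have "(norm (\<Sum>e\<in>E. tensor (g e) e))\<^sup>2 = (\<Sum>e\<in>E. (norm (tensor (g e) e))\<^sup>2)"
    using assms by (intro norm_sum_orthogonal) (auto simp: orthonormal_def pairwise_def cinner_tensor)
  also have "\<dots> = (\<Sum>e\<in>E. (norm (g e))\<^sup>2)"
    using assms by (intro sum.cong) (auto simp: orthonormal_def norm_tensor)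
  finally show ?thesis .
qed

lemma tendsto_tensor:
  assumes "(f \<longlongrightarrow> x) G" "(g \<longlongrightarrow> y) G"
  shows "((\<lambda>n. tensor (f n) (g n)) \<longlongrightarrow> tensor x y) G"
proof -
  have "bounded_bilinear tensor"
  proof
    show "\<exists>K. \<forall>a b. norm (tensor a b) \<le> norm a * norm b * K"
      by (intro exI[of _ 1]) (simp add: norm_tensor)
  qed (simp_all add: tensor_add_left tensor_add_right scaleR_scaleC tensor_scaleC_left tensor_scaleC_right)
  then show ?thesis using assms by (rule bounded_bilinear.tendsto)
qed

text \<open>The finite sums of elementary tensors with entries in countable dense subsets of the factors
  form a countable dense set: a span induction puts each algebraic tensor into their closure.\<close>

lemma separable_tensor_product:
  assumes "separable_space (euclidean :: 'a topology)" "separable_space (euclidean :: 'b topology)"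
  shows "separable_space (euclidean :: 'c topology)"
proof -
  obtain S T where S: "countable S" "closure S = (UNIV :: 'a set)"
    and T: "countable T" "closure T = (UNIV :: 'b set)"
    using assms by (auto simp: separable_space_def)
  define D where "D = (\<lambda>l. sum_list (map (\<lambda>(x, y). tensor x y) l)) ` lists (S \<times> T)"
  have D_add: "tensor x y + d \<in> D" if xy: "x \<in> S" "y \<in> T" and "d \<in> D" for x y d
  proof -
    obtain l where "l \<in> lists (S \<times> T)" "d = sum_list (map (\<lambda>(x, y). tensor x y) l)"
      using \<open>d \<in> D\<close> by (auto simp: D_def)
    then show ?thesis
      using xy unfolding D_def by (intro image_eqI[of _ _ "(x, y) # l"]) auto
  qed
  have "f \<in> closure D" if "f \<in> algebraic_tensors" for f
    using that
  proof (induction rule: algebraic_tensors_induct)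
    case zero
    have "0 \<in> D" unfolding D_def by (rule image_eqI[of _ _ "[]"]) auto
    then show ?case using closure_subset by blast
  next
    case (add x y f)
    obtain d where d: "\<And>n. d n \<in> D" "d \<longlonglongrightarrow> f"
      using add closure_sequential[of f D] by auto
    obtain s where s: "\<And>n. s n \<in> S" "s \<longlonglongrightarrow> x"
      using S closure_sequential[of x S] by auto
    obtain t where t: "\<And>n. t n \<in> T" "t \<longlonglongrightarrow> y"
      using T closure_sequential[of y T] by auto
    have "(\<lambda>n. tensor (s n) (t n) + d n) \<longlonglongrightarrow> tensor x y + f"
      by (intro tendsto_add tendsto_tensor s t d)
    then show ?case
      using D_add[OF s(1) t(1) d(1)]
      by (auto simp: closure_sequential intro!: exI[of _ "\<lambda>n. tensor (s n) (t n) + d n"])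
  qed
  then have "closure algebraic_tensors \<subseteq> closure D"
    by (intro closure_minimal) auto
  then have "closure D = UNIV" using closure_algebraic_tensors by auto
  moreover have "countable D" unfolding D_def using S T by auto
  ultimately show ?thesis by (auto simp: separable_space_def)
qed

section \<open>The frame integral of a tensor product\<close>

lemma weakly_measurable_tensor_map:
  assumes "weakly_measurable M1 F1" "weakly_measurable M2 F2"
  shows "weakly_measurable (M1 \<Otimes>\<^sub>M M2) (tensor_map F1 F2)"
proof (rule weakly_measurable_dense[OF closure_algebraic_tensors])
  have [measurable]: "(\<lambda>x. cinner u (F1 x)) \<in> borel_measurable M1"
      "(\<lambda>x. cinner v (F2 x)) \<in> borel_measurable M2" for u v
    using assms by (auto simp: weakly_measurable_def)
  fix f assume "f \<in> algebraic_tensors"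
  then show "(\<lambda>z. cinner f (tensor_map F1 F2 z)) \<in> borel_measurable (M1 \<Otimes>\<^sub>M M2)"
  proof (induction rule: algebraic_tensors_induct)
    case (add x y f)
    have "(\<lambda>z. cinner x (F1 (fst z)) * cinner y (F2 (snd z)) + cinner f (tensor_map F1 F2 z))
        \<in> borel_measurable (M1 \<Otimes>\<^sub>M M2)"
      by (intro borel_measurable_add add borel_measurable_times) measurable
    then show ?case
      by (simp add: cinner_add_left cinner_tensor case_prod_beta)
  qed (simp add: cinner_zero_left)
qed

lemma frame_integral_tensor:
  assumes "sigma_finite_measure M2" and "weakly_measurable M1 F1" "weakly_measurable M2 F2"
  shows "frame_integral (M1 \<Otimes>\<^sub>M M2) (tensor_map F1 F2) (tensor f g)
    = frame_integral M1 F1 f * frame_integral M2 F2 g"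
proof -
  interpret sigma_finite_measure M2 by fact
  have "frame_integral (M1 \<Otimes>\<^sub>M M2) (tensor_map F1 F2) (tensor f g)
      = (\<integral>\<^sup>+x. \<integral>\<^sup>+y. ennreal ((cmod (cinner (tensor f g) (tensor_map F1 F2 (x, y))))\<^sup>2) \<partial>M2 \<partial>M1)"
    unfolding frame_integral_def
    by (intro nn_integral_fst[symmetric] frame_integral_measurable weakly_measurable_tensor_map assms)
  also have "\<dots> = (\<integral>\<^sup>+x. \<integral>\<^sup>+y. ennreal ((cmod (cinner f (F1 x)))\<^sup>2) * ennreal ((cmod (cinner g (F2 y)))\<^sup>2) \<partial>M2 \<partial>M1)"
    by (simp add: cinner_tensor norm_mult power_mult_distrib ennreal_mult)
  also have "\<dots> = (\<integral>\<^sup>+x. ennreal ((cmod (cinner f (F1 x)))\<^sup>2) * frame_integral M2 F2 g \<partial>M1)"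
    unfolding frame_integral_def
    by (intro nn_integral_cong nn_integral_cmult frame_integral_measurable assms)
  also have "\<dots> = frame_integral M1 F1 f * frame_integral M2 F2 g"
    unfolding frame_integral_def
    by (intro nn_integral_multc frame_integral_measurable assms)
  finally show ?thesis .
qed

text \<open>After integration over the second variable, the coefficient of a tensor becomes a frame integral
  of \<open>F2\<close> at a vector that depends on \<open>x\<close>; this is where the bounds of \<open>F2\<close> enter.\<close>

lemma frame_integral_orthonormal_form:
  assumes "sigma_finite_measure M2" and "weakly_measurable M1 F1" "weakly_measurable M2 F2"
  shows "frame_integral (M1 \<Otimes>\<^sub>M M2) (tensor_map F1 F2) (\<Sum>e\<in>E. tensor (g e) e)
    = (\<integral>\<^sup>+x. frame_integral M2 F2 (\<Sum>e\<in>E. cinner (g e) (F1 x) *\<^sub>C e) \<partial>M1)"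
proof -
  interpret sigma_finite_measure M2 by fact
  have "frame_integral (M1 \<Otimes>\<^sub>M M2) (tensor_map F1 F2) (\<Sum>e\<in>E. tensor (g e) e)
      = (\<integral>\<^sup>+x. \<integral>\<^sup>+y. ennreal ((cmod (cinner (\<Sum>e\<in>E. tensor (g e) e) (tensor_map F1 F2 (x, y))))\<^sup>2) \<partial>M2 \<partial>M1)"
    unfolding frame_integral_def
    by (intro nn_integral_fst[symmetric] frame_integral_measurable weakly_measurable_tensor_map assms)
  then show ?thesis
    by (simp add: frame_integral_def cinner_sum_left cinner_tensor cinner_scaleC_left)
qed

text \<open>For orthonormal \<open>E\<close> the squared norm is the sum of the squared coefficients, so the integral
  splits into frame integrals of \<open>F1\<close>.\<close>

lemma sum_frame_integral_orthonormal:
  assumes "weakly_measurable M1 F1" "finite E" "orthonormal E"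
  shows "(\<integral>\<^sup>+x. K * ennreal ((norm (\<Sum>e\<in>E. cinner (g e) (F1 x) *\<^sub>C e))\<^sup>2) \<partial>M1)
    = K * (\<Sum>e\<in>E. frame_integral M1 F1 (g e))"
proof -
  have "(\<integral>\<^sup>+x. K * ennreal ((norm (\<Sum>e\<in>E. cinner (g e) (F1 x) *\<^sub>C e))\<^sup>2) \<partial>M1)
      = (\<integral>\<^sup>+x. K * (\<Sum>e\<in>E. ennreal ((cmod (cinner (g e) (F1 x)))\<^sup>2)) \<partial>M1)"
    by (simp add: norm_sum_orthonormal assms)
  also have "\<dots> = K * (\<integral>\<^sup>+x. (\<Sum>e\<in>E. ennreal ((cmod (cinner (g e) (F1 x)))\<^sup>2)) \<partial>M1)"
    by (intro nn_integral_cmult borel_measurable_sum frame_integral_measurable assms)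
  also have "\<dots> = K * (\<Sum>e\<in>E. frame_integral M1 F1 (g e))"
    unfolding frame_integral_def
    by (intro arg_cong[where f = "(*) K"] nn_integral_sum frame_integral_measurable assms)
  finally show ?thesis .
qed

lemma upper_frame_bound_tensor_map:
  assumes \<sigma>: "sigma_finite_measure M2" and wm: "weakly_measurable M1 F1" "weakly_measurable M2 F2"
    and B1: "upper_frame_bound M1 F1 B1" and B2: "upper_frame_bound M2 F2 B2"
  shows "upper_frame_bound (M1 \<Otimes>\<^sub>M M2) (tensor_map F1 F2) (B1 * B2)"
proof (rule upper_frame_bound_dense[OF closure_algebraic_tensors])
  fix f assume "f \<in> algebraic_tensors"
  then obtain E g where E: "finite E" "orthonormal E" and f: "f = (\<Sum>e\<in>E. tensor (g e) e)"
    by (rule algebraic_tensor_orthonormal_form)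
  have "frame_integral (M1 \<Otimes>\<^sub>M M2) (tensor_map F1 F2) f
      = (\<integral>\<^sup>+x. frame_integral M2 F2 (\<Sum>e\<in>E. cinner (g e) (F1 x) *\<^sub>C e) \<partial>M1)"
    unfolding f by (rule frame_integral_orthonormal_form[OF \<sigma> wm])
  also have "\<dots> \<le> (\<integral>\<^sup>+x. B2 * ennreal ((norm (\<Sum>e\<in>E. cinner (g e) (F1 x) *\<^sub>C e))\<^sup>2) \<partial>M1)"
    using B2 by (intro nn_integral_mono) (auto simp: upper_frame_bound_def)
  also have "\<dots> = B2 * (\<Sum>e\<in>E. frame_integral M1 F1 (g e))"
    by (rule sum_frame_integral_orthonormal[OF wm(1) E])
  also have "\<dots> \<le> B2 * (\<Sum>e\<in>E. B1 * ennreal ((norm (g e))\<^sup>2))"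
    using B1 by (intro mult_left_mono sum_mono) (auto simp: upper_frame_bound_def)
  also have "\<dots> = B1 * B2 * ennreal ((norm f)\<^sup>2)"
    by (simp add: f norm_orthonormal_form[OF E] sum_distrib_left[symmetric] ac_simps)
  finally show "frame_integral (M1 \<Otimes>\<^sub>M M2) (tensor_map F1 F2) f \<le> B1 * B2 * ennreal ((norm f)\<^sup>2)" .
next
  show "B1 * B2 < \<infinity>"
    using B1 B2 unfolding upper_frame_bound_def ennreal_mult_less_top infinity_ennreal_def by blast
qed (rule weakly_measurable_tensor_map[OF wm])

text \<open>The upper bounds carry the estimate from the algebraic tensors to their closure.\<close>

lemma lower_frame_bound_tensor_map:
  assumes \<sigma>: "sigma_finite_measure M2" and wm: "weakly_measurable M1 F1" "weakly_measurable M2 F2"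
    and B1: "upper_frame_bound M1 F1 B1" and B2: "upper_frame_bound M2 F2 B2"
    and A1: "lower_frame_bound M1 F1 A1" and A2: "lower_frame_bound M2 F2 A2"
  shows "lower_frame_bound (M1 \<Otimes>\<^sub>M M2) (tensor_map F1 F2) (A1 * A2)"
proof (rule lower_frame_bound_dense[OF closure_algebraic_tensors weakly_measurable_tensor_map[OF wm]
      upper_frame_bound_tensor_map[OF \<sigma> wm B1 B2]])
  fix f assume "f \<in> algebraic_tensors"
  then obtain E g where E: "finite E" "orthonormal E" and f: "f = (\<Sum>e\<in>E. tensor (g e) e)"
    by (rule algebraic_tensor_orthonormal_form)
  have "A1 * A2 * ennreal ((norm f)\<^sup>2) = A2 * (\<Sum>e\<in>E. A1 * ennreal ((norm (g e))\<^sup>2))"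
    by (simp add: f norm_orthonormal_form[OF E] sum_distrib_left[symmetric] mult.assoc mult.left_commute[of A1])
  also have "\<dots> \<le> A2 * (\<Sum>e\<in>E. frame_integral M1 F1 (g e))"
    using A1 by (intro mult_left_mono sum_mono) (auto simp: lower_frame_bound_def)
  also have "\<dots> = (\<integral>\<^sup>+x. A2 * ennreal ((norm (\<Sum>e\<in>E. cinner (g e) (F1 x) *\<^sub>C e))\<^sup>2) \<partial>M1)"
    by (rule sum_frame_integral_orthonormal[OF wm(1) E, symmetric])
  also have "\<dots> \<le> (\<integral>\<^sup>+x. frame_integral M2 F2 (\<Sum>e\<in>E. cinner (g e) (F1 x) *\<^sub>C e) \<partial>M1)"
    using A2 by (intro nn_integral_mono) (auto simp: lower_frame_bound_def)
  also have "\<dots> = frame_integral (M1 \<Otimes>\<^sub>M M2) (tensor_map F1 F2) f"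
    unfolding f by (rule frame_integral_orthonormal_form[OF \<sigma> wm, symmetric])
  finally show "A1 * A2 * ennreal ((norm f)\<^sup>2) \<le> frame_integral (M1 \<Otimes>\<^sub>M M2) (tensor_map F1 F2) f" .
next
  show "0 < A1 * A2"
    using A1 A2 unfolding lower_frame_bound_def ennreal_zero_less_mult_iff by blast
  show "A1 * A2 < \<infinity>"
    using A1 A2 unfolding lower_frame_bound_def ennreal_mult_less_top infinity_ennreal_def by blast
qed

section \<open>Recovering the factors\<close>

text \<open>The lower bound at \<open>u \<otimes> v\<close> with nonzero \<open>u\<close>, \<open>v\<close> provides a point \<open>(a, b)\<close> of the product where
  the coefficient does not vanish.  The section of \<open>(x, y) \<mapsto> \<langle>f, F1 x\<rangle> \<langle>v, F2 y\<rangle>\<close> at \<open>y = b\<close> is then a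
  nonzero multiple of the coefficient of \<open>F1\<close> at \<open>f\<close>, and likewise for \<open>F2\<close>.\<close>

lemma weakly_measurable_factors:
  assumes nz: "\<exists>h::'a. h \<noteq> 0" "\<exists>h::'b. h \<noteq> 0"
    and wm: "weakly_measurable (M1 \<Otimes>\<^sub>M M2) (tensor_map F1 F2)"
    and lower: "lower_frame_bound (M1 \<Otimes>\<^sub>M M2) (tensor_map F1 F2) A"
  shows "weakly_measurable M1 F1" "weakly_measurable M2 F2"
proof -
  obtain u v where "(u::'a) \<noteq> 0" "(v::'b) \<noteq> 0" using nz by blast
  then have "0 < A * ennreal ((norm (tensor u v))\<^sup>2)"
    using lower by (simp add: norm_tensor lower_frame_bound_def ennreal_zero_less_mult_iff)
  also have "\<dots> \<le> frame_integral (M1 \<Otimes>\<^sub>M M2) (tensor_map F1 F2) (tensor u v)"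
    using lower by (simp add: lower_frame_bound_def)
  finally have pos: "frame_integral (M1 \<Otimes>\<^sub>M M2) (tensor_map F1 F2) (tensor u v) \<noteq> 0" by simp
  have "\<exists>z\<in>space (M1 \<Otimes>\<^sub>M M2). cinner (tensor u v) (tensor_map F1 F2 z) \<noteq> 0"
  proof (rule ccontr)
    assume "\<not> ?thesis"
    then have "frame_integral (M1 \<Otimes>\<^sub>M M2) (tensor_map F1 F2) (tensor u v) = (\<integral>\<^sup>+z. 0 \<partial>(M1 \<Otimes>\<^sub>M M2))"
      unfolding frame_integral_def by (intro nn_integral_cong) auto
    with pos show False by simp
  qed
  then obtain a b where ab: "a \<in> space M1" "b \<in> space M2"
      "cinner u (F1 a) \<noteq> 0" "cinner v (F2 b) \<noteq> 0"
    by (auto simp: space_pair_measure cinner_tensor)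
  have meas: "(\<lambda>z. cinner (tensor f g) (tensor_map F1 F2 z)) \<in> borel_measurable (M1 \<Otimes>\<^sub>M M2)" for f g
    using wm by (simp add: weakly_measurable_def)
  show "weakly_measurable M1 F1"
    unfolding weakly_measurable_def
  proof
    fix f
    have "(\<lambda>x. cinner f (F1 x) * cinner v (F2 b)) \<in> borel_measurable M1"
      using measurable_Pair1[OF meas[of f v] ab(2)] by (simp add: cinner_tensor)
    then have "(\<lambda>x. cinner f (F1 x) * cinner v (F2 b) / cinner v (F2 b)) \<in> borel_measurable M1"
      by measurable
    then show "(\<lambda>x. cinner f (F1 x)) \<in> borel_measurable M1" using ab by simp
  qed
  show "weakly_measurable M2 F2"
    unfolding weakly_measurable_def
  proof
    fix g
    have "(\<lambda>y. cinner u (F1 a) * cinner g (F2 y)) \<in> borel_measurable M2"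
      using measurable_Pair2[OF meas[of u g] ab(1)] by (simp add: cinner_tensor)
    then have "(\<lambda>y. cinner u (F1 a) * cinner g (F2 y) / cinner u (F1 a)) \<in> borel_measurable M2"
      by measurable
    then show "(\<lambda>y. cinner g (F2 y)) \<in> borel_measurable M2" using ab by simp
  qed
qed

end

lemma exists_unit_vector:
  fixes h :: "'a::chilbert_space"
  assumes "h \<noteq> 0"
  obtains u :: 'a where "norm u = 1"
proof -
  have "norm ((1 / norm h) *\<^sub>R h) = 1" using assms by simp
  then show thesis by (rule that)
qed

text \<open>Only the product of the two frame integrals enters, so the tensor product is not mentioned and
  the lemma serves both factors.  Dividing an inequality between extended nonnegative reals is
  sound only for positive finite divisors, so these properties have to be shown of the infimum and the
  supremum.  The lower bound makes the
  integrals positive at nonzero vectors, and then a finite product forces both of its factors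
  to be finite.\<close>

lemma factor_frame_bounds:
  fixes F :: "'x \<Rightarrow> 'a::chilbert_space" and G :: "'y \<Rightarrow> 'b::chilbert_space"
  assumes nz: "\<exists>h::'a. h \<noteq> 0" "\<exists>h::'b. h \<noteq> 0"
    and A: "0 < A" "A < \<infinity>" and B: "B < \<infinity>"
    and lower: "\<And>f g. A * ennreal ((norm f)\<^sup>2 * (norm g)\<^sup>2) \<le> frame_integral M F f * frame_integral N G g"
    and upper: "\<And>f g. frame_integral M F f * frame_integral N G g \<le> B * ennreal ((norm f)\<^sup>2 * (norm g)\<^sup>2)"
  shows "lower_frame_bound M F (A / frame_inf N G)" "upper_frame_bound M F (B / frame_sup N G)"
proof -
  obtain u :: 'a where u: "norm u = 1" using nz(1) exists_unit_vector by blast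
  obtain v :: 'b where v: "norm v = 1" using nz(2) exists_unit_vector by blast
  have low1: "A * ennreal ((norm f)\<^sup>2) \<le> frame_integral M F f * frame_integral N G g" if "norm g = 1" for f g
    using lower[of f g] that by simp
  have up1: "frame_integral M F f * frame_integral N G g \<le> B * ennreal ((norm f)\<^sup>2)" if "norm g = 1" for f g
    using upper[of f g] that by simp
  have v_pos: "0 < frame_integral N G v"
    using low1[OF v, of u] A u by (auto simp: ennreal_zero_less_mult_iff intro: gr_zeroI)
  have fin: "frame_integral M F f < \<infinity>" for f
  proof (rule ccontr)
    assume "\<not> ?thesis"
    then have "frame_integral M F f * frame_integral N G v = \<infinity>"
      using v_pos by (simp add: ennreal_top_mult less_top[symmetric])
    moreover have "B * ennreal ((norm f)\<^sup>2) < \<infinity>" using B by (simp add: ennreal_mult_less_top)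
    ultimately show False using up1[OF v, of f] by simp
  qed
  have u_pos: "0 < frame_integral M F u"
    using low1[OF v, of u] A u by (auto intro: gr_zeroI)
  have v_fin: "frame_integral N G v < \<infinity>"
  proof (rule ccontr)
    assume "\<not> ?thesis"
    then have "frame_integral M F u * frame_integral N G v = \<infinity>"
      using u_pos by (simp add: ennreal_mult_top less_top[symmetric])
    then show False using up1[OF v, of u] B u by simp
  qed
  have quotient_le: "A * ennreal ((norm f)\<^sup>2) / frame_integral M F f \<le> frame_inf N G"
    if "0 < frame_integral M F f" for f
    unfolding frame_inf_def by (intro INF_greatest divide_le_posI_ennreal[OF that] low1) simp
  have "0 < A * ennreal ((norm u)\<^sup>2) / frame_integral M F u"
    using A u fin[of u] by (simp add: ennreal_zero_less_divide)
  also have "\<dots> \<le> frame_inf N G"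
    using u_pos by (rule quotient_le)
  finally have C_pos: "0 < frame_inf N G" .
  have "frame_inf N G \<le> frame_integral N G v"
    unfolding frame_inf_def using v by (intro INF_lower) simp
  then have C_fin: "frame_inf N G < \<infinity>" using v_fin by (rule le_less_trans)
  have "frame_integral N G v \<le> frame_sup N G"
    unfolding frame_sup_def using v by (intro SUP_upper) simp
  with v_pos have D_pos: "0 < frame_sup N G" by (rule less_le_trans)
  have up_D: "frame_integral M F f * frame_sup N G \<le> B * ennreal ((norm f)\<^sup>2)" for f
    unfolding frame_sup_def SUP_mult_left_ennreal by (intro SUP_least up1) simp
  have D_fin: "frame_sup N G < \<infinity>"
  proof (rule ccontr)
    assume "\<not> ?thesis"
    then have "frame_integral M F u * frame_sup N G = \<infinity>"
      using u_pos by (simp add: ennreal_mult_top less_top[symmetric])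
    then show False using up_D[of u] B u by simp
  qed
  have low_C: "A * ennreal ((norm f)\<^sup>2) \<le> frame_integral M F f * frame_inf N G" for f
  proof (cases "frame_integral M F f = 0")
    case True
    then show ?thesis using low1[OF v, of f] by simp
  next
    case False
    then have "A * ennreal ((norm f)\<^sup>2)
        = frame_integral M F f * (A * ennreal ((norm f)\<^sup>2) / frame_integral M F f)"
      using fin[of f] by (simp add: ennreal_times_divide ennreal_mult_divide_eq mult.commute[of "frame_integral M F f"])
    also have "\<dots> \<le> frame_integral M F f * frame_inf N G"
      using False by (intro mult_left_mono quotient_le) (simp_all add: zero_less_iff_neq_zero)
    finally show ?thesis .
  qed
  show "lower_frame_bound M F (A / frame_inf N G)"
    unfolding lower_frame_bound_def
  proof (intro conjI allI)
    show "0 < A / frame_inf N G" using A C_fin by (simp add: ennreal_zero_less_divide)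
    show "A / frame_inf N G < \<infinity>" using A C_pos by (auto simp: ennreal_divide_eq_top_iff less_top[symmetric])
    fix f :: 'a
    have "A / frame_inf N G * ennreal ((norm f)\<^sup>2) = A * ennreal ((norm f)\<^sup>2) / frame_inf N G"
      by (simp add: ennreal_divide_times ennreal_times_divide)
    also have "\<dots> \<le> frame_integral M F f"
      using low_C[of f] by (intro divide_le_posI_ennreal C_pos) (simp add: mult.commute)
    finally show "A / frame_inf N G * ennreal ((norm f)\<^sup>2) \<le> frame_integral M F f" .
  qed
  show "upper_frame_bound M F (B / frame_sup N G)"
    unfolding upper_frame_bound_def
  proof (intro conjI allI)
    show "B / frame_sup N G < \<infinity>" using B D_pos by (auto simp: ennreal_divide_eq_top_iff less_top[symmetric])
    fix f :: 'a
    have "frame_integral M F f = frame_integral M F f * frame_sup N G / frame_sup N G"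
      using D_pos D_fin by (simp add: ennreal_mult_divide_eq)
    also have "\<dots> \<le> B * ennreal ((norm f)\<^sup>2) / frame_sup N G"
      by (intro divide_right_mono_ennreal up_D)
    also have "\<dots> = B / frame_sup N G * ennreal ((norm f)\<^sup>2)"
      by (simp add: ennreal_divide_times ennreal_times_divide)
    finally show "frame_integral M F f \<le> B / frame_sup N G * ennreal ((norm f)\<^sup>2)" .
  qed
qed

section \<open>Frames and their tensor products\<close>

theorem theorem3p3:
  fixes tensor :: "'a::chilbert_space \<Rightarrow> 'b::chilbert_space \<Rightarrow> 'c::chilbert_space"
    and M1 :: "'x measure" and M2 :: "'y measure"
    and F1 :: "'x \<Rightarrow> 'a" and F2 :: "'y \<Rightarrow> 'b" and F :: "'x \<times> 'y \<Rightarrow> 'c"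
  assumes "\<exists>h::'a. h \<noteq> 0" and "\<exists>h::'b. h \<noteq> 0"
    and "separable_space (euclidean :: 'a topology)"
    and "separable_space (euclidean :: 'b topology)"
    and "hilbert_tensor_product tensor"
    and "sigma_finite_measure M1" and "sigma_finite_measure M2"
    and "F = (\<lambda>(x1, x2). tensor (F1 x1) (F2 x2))"
  shows "(continuous_frame (M1 \<Otimes>\<^sub>M M2) F \<longleftrightarrow> continuous_frame M1 F1 \<and> continuous_frame M2 F2)
    \<and> (\<forall>A B. continuous_frame (M1 \<Otimes>\<^sub>M M2) F
          \<and> lower_frame_bound (M1 \<Otimes>\<^sub>M M2) F A \<and> upper_frame_bound (M1 \<Otimes>\<^sub>M M2) F B \<longrightarrow>
        lower_frame_bound M1 F1 (A / frame_inf M2 F2) \<and> upper_frame_bound M1 F1 (B / frame_sup M2 F2)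
        \<and> lower_frame_bound M2 F2 (A / frame_inf M1 F1) \<and> upper_frame_bound M2 F2 (B / frame_sup M1 F1))
    \<and> (\<forall>A1 B1 A2 B2. continuous_frame M1 F1 \<and> lower_frame_bound M1 F1 A1 \<and> upper_frame_bound M1 F1 B1
          \<and> continuous_frame M2 F2 \<and> lower_frame_bound M2 F2 A2 \<and> upper_frame_bound M2 F2 B2 \<longrightarrow>
        lower_frame_bound (M1 \<Otimes>\<^sub>M M2) F (A1 * A2) \<and> upper_frame_bound (M1 \<Otimes>\<^sub>M M2) F (B1 * B2))"
proof -
  interpret hilbert_tensor_product tensor by fact
  interpret M: pair_sigma_finite M1 M2
    using assms(6,7) by (simp add: pair_sigma_finite_def)
  have F: "F = tensor_map F1 F2" by fact
  have factors: "lower_frame_bound M1 F1 (A / frame_inf M2 F2) \<and> upper_frame_bound M1 F1 (B / frame_sup M2 F2)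
        \<and> lower_frame_bound M2 F2 (A / frame_inf M1 F1) \<and> upper_frame_bound M2 F2 (B / frame_sup M1 F1)"
    and factors_wm: "weakly_measurable M1 F1 \<and> weakly_measurable M2 F2"
    if frame: "continuous_frame (M1 \<Otimes>\<^sub>M M2) F"
      and A: "lower_frame_bound (M1 \<Otimes>\<^sub>M M2) F A" and B: "upper_frame_bound (M1 \<Otimes>\<^sub>M M2) F B" for A B
  proof -
    have wm: "weakly_measurable M1 F1" "weakly_measurable M2 F2"
      using weakly_measurable_factors[OF assms(1,2), of M1 M2 F1 F2 A] frame A
      by (auto simp: continuous_frame_def F)
    then show "weakly_measurable M1 F1 \<and> weakly_measurable M2 F2" by simp
    have prod: "frame_integral M1 F1 f * frame_integral M2 F2 g = frame_integral (M1 \<Otimes>\<^sub>M M2) F (tensor f g)" for f g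
      unfolding F by (rule frame_integral_tensor[OF assms(7) wm, symmetric])
    have low: "A * ennreal ((norm f)\<^sup>2 * (norm g)\<^sup>2) \<le> frame_integral M1 F1 f * frame_integral M2 F2 g" for f g
      using A unfolding prod lower_frame_bound_def by (metis norm_tensor power_mult_distrib)
    have up: "frame_integral M1 F1 f * frame_integral M2 F2 g \<le> B * ennreal ((norm f)\<^sup>2 * (norm g)\<^sup>2)" for f g
      using B unfolding prod upper_frame_bound_def by (metis norm_tensor power_mult_distrib)
    have AB: "0 < A" "A < \<infinity>" "B < \<infinity>"
      using A B by (auto simp: lower_frame_bound_def upper_frame_bound_def)
    show "lower_frame_bound M1 F1 (A / frame_inf M2 F2) \<and> upper_frame_bound M1 F1 (B / frame_sup M2 F2)
        \<and> lower_frame_bound M2 F2 (A / frame_inf M1 F1) \<and> upper_frame_bound M2 F2 (B / frame_sup M1 F1)"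
      using factor_frame_bounds[OF assms(1,2) AB low up]
        factor_frame_bounds[OF assms(2,1) AB, of M2 F2 M1 F1] low up
      by (simp add: mult.commute)
  qed
  have product: "lower_frame_bound (M1 \<Otimes>\<^sub>M M2) F (A1 * A2) \<and> upper_frame_bound (M1 \<Otimes>\<^sub>M M2) F (B1 * B2)"
    if "continuous_frame M1 F1" "lower_frame_bound M1 F1 A1" "upper_frame_bound M1 F1 B1"
      "continuous_frame M2 F2" "lower_frame_bound M2 F2 A2" "upper_frame_bound M2 F2 B2" for A1 B1 A2 B2
    using that lower_frame_bound_tensor_map[OF assms(7)] upper_frame_bound_tensor_map[OF assms(7)]
    unfolding F continuous_frame_def by blast
  have "continuous_frame M1 F1 \<and> continuous_frame M2 F2" if frame: "continuous_frame (M1 \<Otimes>\<^sub>M M2) F"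
  proof -
    obtain A B where "lower_frame_bound (M1 \<Otimes>\<^sub>M M2) F A" "upper_frame_bound (M1 \<Otimes>\<^sub>M M2) F B"
      using frame unfolding continuous_frame_def by blast
    from factors[OF frame this] factors_wm[OF frame this] show ?thesis
      using assms(3,4,6,7) unfolding continuous_frame_def by blast
  qed
  moreover have "continuous_frame (M1 \<Otimes>\<^sub>M M2) F" if frames: "continuous_frame M1 F1" "continuous_frame M2 F2"
  proof -
    obtain A1 B1 A2 B2 where "lower_frame_bound M1 F1 A1" "upper_frame_bound M1 F1 B1"
      "lower_frame_bound M2 F2 A2" "upper_frame_bound M2 F2 B2"
      using frames unfolding continuous_frame_def by blast
    from product[OF frames(1) this(1,2) frames(2) this(3,4)]
    have "\<exists>A. lower_frame_bound (M1 \<Otimes>\<^sub>M M2) F A" "\<exists>B. upper_frame_bound (M1 \<Otimes>\<^sub>M M2) F B"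
      by blast+
    moreover have "weakly_measurable (M1 \<Otimes>\<^sub>M M2) F"
      using frames unfolding F continuous_frame_def by (intro weakly_measurable_tensor_map) auto
    ultimately show ?thesis
      using separable_tensor_product[OF assms(3,4)] M.sigma_finite_measure_axioms
      by (simp add: continuous_frame_def)
  qed
  ultimately show ?thesis using factors product by blast
qed

end
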